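(* For all bouquets $\Phi,\Psi$: $\Phi\to^*\Psi$ holds if and only if $(\Psi\rhd\Phi)\to^*\emptyset$, where $\to^*$ is derivability in the full flower calculus $\mathsf N\cup\mathsf C$.
   Context: Fix a countable set $\mathcal{V}$ of variables and a first-order signature consisting of a countable set $\mathcal{P}$ of predicate symbols with an arity function $\mathrm{ar}:\mathcal{P}\to\mathbb{N}$. Flowers and gardens are defined by mutual induction: (1) if $p\in\mathcal{P}$ and $\vec{x}\in\mathcal{V}^{\mathrm{ar}(p)}$, then the atom $p(\vec{x})$ is a flower; (2) if $\mathbf{x}\subset\mathcal{V}$ is a finite set (a sprinkler; its elements are binders) and $\Phi$ is a finite multiset of flowers (a bouquet), then $\mathbf{x}\cdot\Phi$ is a garden; (3) if $\gamma$ is a garden (the pistil) and $\Delta$ is a finite multiset of gardens (a corolla, whose elements are petals), then $\gamma\rhd\Delta$ is a flower, also written $\gamma\rhd\delta_1;\dots;\delta_n$ when $\Delta=\{\delta_1,\dots,\delta_n\}$. A garden $\emptyset\cdot\Phi$ is written simply $\Phi$; the empty bouquet is $\emptyset$; a comma denotes multiset union of bouquets (a flower being identified with a singleton bouquet); $\mathbf{x},\mathbf{y}$ denotes $\mathbf{x}\cup\mathbf{y}$. For bouquets $\Psi,\Phi$, $(\Psi\rhd\Phi)$ denotes the flower with pistil $\emptyset\cdot\Psi$ and single petal $\emptyset\cdot\Phi$. Free variables: $\mathrm{fv}(p(\vec x))$ is the set of variables in $\vec x$; $\mathrm{fv}(\Phi)=\bigcup_{\phi\in\Phi}\mathrm{fv}(\phi)$;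 $\mathrm{fv}(\mathbf{x}\cdot\Phi)=\mathrm{fv}(\Phi)\setminus\mathbf{x}$; $\mathrm{fv}(\mathbf{x}\cdot\Phi\rhd\Delta)=\mathrm{fv}(\mathbf{x}\cdot\Phi)\cup\bigcup_{\mathbf{y}\cdot\Psi\in\Delta}\mathrm{fv}((\mathbf{x}\cup\mathbf{y})\cdot\Psi)$. Bound variables: $\mathrm{bv}(p(\vec x))=\emptyset$; $\mathrm{bv}(\Phi)=\bigcup_{\phi\in\Phi}\mathrm{bv}(\phi)$; $\mathrm{bv}(\mathbf{x}\cdot\Phi)=\mathbf{x}\cup\mathrm{bv}(\Phi)$; $\mathrm{bv}(\gamma\rhd\Delta)=\mathrm{bv}(\gamma)\cup\bigcup_{\delta\in\Delta}\mathrm{bv}(\delta)$. Standing convention: every bouquet $\Phi$ considered has pairwise distinct binders and satisfies $\mathrm{bv}(\Phi)\cap\mathrm{fv}(\Phi)=\emptyset$. Substitutions: for $f,g:A\to B$ and $R\subseteq A$, $f[R\mapsto g]$ equals $g$ on $R$ and $f$ elsewhere (left-associative; omitted $f$ or $g$ means identity). A substitution is $\sigma:\mathcal V\to\mathcal V$ with finite support $\{x\mid\sigma(x)\ne x\}$; $\sigma:\mathbf y$ means its support is $\mathbf y$; $\sigma_{-\mathbf x}:=\sigma[\mathbf x\mapsto\mathrm{id}]$. Action: $\sigma(p(x_1,\dots,x_n))=p(\sigma(x_1),\dots,\sigma(x_n))$, elementwise on bouquets, $\sigma(\mathbf x\cdot\Phi)=\mathbf x\cdot\sigma_{-\mathbf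 x}(\Phi)$, $\sigma(\mathbf x\cdot\Phi\rhd\delta_1;\dots;\delta_n)=\sigma(\mathbf x\cdot\Phi)\rhd\sigma_{-\mathbf x}(\delta_1);\dots;\sigma_{-\mathbf x}(\delta_n)$. $\sigma:\mathbf y$ is capture-avoiding in $\Phi$ if $\sigma(\mathbf y)\cap\mathrm{bv}(\Phi)=\emptyset$. Contexts: $\Xi::=\Psi,\xi$ and $\xi::=\Box\mid(\mathbf x\cdot\Xi\rhd\Delta)\mid(\gamma\rhd\mathbf x\cdot\Xi;\Delta)$ ($\Psi$ a bouquet, $\gamma$ a garden, $\Delta$ a corolla). $\Xi\{\Psi\}$ replaces the hole $\Box$ by the bouquet $\Psi$, $\Xi\{\}$ by $\emptyset$, $\Xi\{\Xi'\}$ by a context $\Xi'$. Inversions: $\mathrm{inv}(\Box)=0$, $\mathrm{inv}(\Psi,\xi)=\mathrm{inv}(\xi)$, $\mathrm{inv}(\mathbf x\cdot\Xi\rhd\Delta)=1+\mathrm{inv}(\Xi)$, $\mathrm{inv}(\gamma\rhd\mathbf x\cdot\Xi;\Delta)=\mathrm{inv}(\Xi)$; $\Xi$ is positive ($\Xi^+$) if this is even, negative ($\Xi^-$) otherwise. A flower $\phi$ can be pollinated in $\Xi$ if there are a bouquet $\Psi\ni\phi$ and contexts $\Xi',\Xi_0$ with either $\Xi=\Xi'\{\Psi,\Xi_0\}$ or $\Xi=\Xi'\{\mathbf x\cdot\Psi\rhd\mathbf y\cdot\Xi_0;\Delta\}$ for some $\mathbf x,\mathbf y,\Delta$; a bouquet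 can be pollinated in $\Xi$ if each of its flowers can. Rules (steps $\Phi\to\Psi$, $\Phi$ the conclusion, $\Psi$ the premiss). Natural rules $\mathsf N$: (poll↓) $\Xi\{\Phi\}\to\Xi\{\}$ and (poll↑) $\Xi\{\}\to\Xi\{\Phi\}$ whenever $\Phi$ can be pollinated in $\Xi$; (epis) $\Phi\to(\emptyset\cdot\emptyset\rhd\emptyset\cdot\Phi)$; (epet) $(\gamma\rhd\emptyset\cdot\emptyset;\Delta)\to\emptyset$; (srep) $(\mathbf x\cdot(\Phi,(\emptyset\cdot\emptyset\rhd\gamma_1;\dots;\gamma_n))\rhd\Delta)\to(\mathbf x\cdot\Phi\rhd\emptyset\cdot\{(\gamma_1\rhd\Delta),\dots,(\gamma_n\rhd\Delta)\})$; (ipis) $(\mathbf x,\mathbf y\cdot\Phi\rhd\Delta)\to(\mathbf x\cdot\sigma(\Phi)\rhd\sigma(\Delta)),(\mathbf x,\mathbf y\cdot\Phi\rhd\Delta)$; (ipet) $(\gamma\rhd\mathbf x,\mathbf y\cdot\Phi;\Delta)\to(\gamma\rhd\mathbf x\cdot\sigma(\Phi);\mathbf x,\mathbf y\cdot\Phi;\Delta)$. Cultural rules $\mathsf C$: (grow) $\Xi^+\{\}\to\Xi^+\{\Phi\}$; (crop) $\Xi^-\{\Phi\}\to\Xi^-\{\}$; (pull) $\Xi^+\{\gamma\rhd\Gamma;\Delta\}\to\Xi^+\{\gamma\rhd\Delta\}$; (glue) $\Xi^-\{\gamma\rhd\Delta\}\to\Xi^-\{\gamma\rhd\Gamma;\Delta\}$;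 (apis) $\Xi^+\{\mathbf x\cdot\sigma(\Phi)\rhd\sigma(\Delta)\}\to\Xi^+\{\mathbf x,\mathbf y\cdot\Phi\rhd\Delta\}$; (apet) $\Xi^-\{\gamma\rhd\mathbf x\cdot\sigma(\Phi);\Delta\}\to\Xi^-\{\gamma\rhd\mathbf x,\mathbf y\cdot\Phi;\Delta\}$. In ipis/apis, $\sigma:\mathbf y$ is capture-avoiding in $(\emptyset\cdot\Phi\rhd\Delta)$; in ipet/apet, $\sigma:\mathbf y$ is capture-avoiding in $\Phi$. Natural steps are closed under arbitrary contexts: if $\Phi\to\Psi$ is an instance of an $\mathsf N$-rule then $\Xi\{\Phi\}\to_{\mathsf N}\Xi\{\Psi\}$ for every context $\Xi$. For a rule set $\mathsf R$, $\Phi\to^*_{\mathsf R}\Psi$ means a finite (possibly empty) sequence of $\mathsf R$-steps from $\Phi$ to $\Psi$; $\to^*$ without subscript means $\mathsf N\cup\mathsf C$. *)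

theory Defs
  imports "HOL-Library.Multiset" "HOL-Library.FSet" "HOL-Library.Countable"
begin

datatype ('p, 'v) flower =
    Atom 'p "'v list"
  | Flower "('p, 'v) garden" "('p, 'v) garden multiset"  (infix \<open>\<rhd>\<close> 62)
and ('p, 'v) garden =
    Garden (sprinkler: "'v fset") (garden_bouquet: "('p, 'v) flower multiset")  (infix \<open>\<cdot>\<close> 63)

type_synonym ('p, 'v) bouquet = "('p, 'v) flower multiset"
type_synonym ('p, 'v) corolla = "('p, 'v) garden multiset"

abbreviation bouquet_flower :: "('p, 'v) bouquet \<Rightarrow> ('p, 'v) bouquet \<Rightarrow> ('p, 'v) flower" where
  "bouquet_flower \<Psi> \<Phi> \<equiv> ({||} \<cdot> \<Psi>) \<rhd> {# {||} \<cdot> \<Phi> #}"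

primrec respects_arity_flower :: "('p \<Rightarrow> nat) \<Rightarrow> ('p, 'v) flower \<Rightarrow> bool"
  and respects_arity_garden :: "('p \<Rightarrow> nat) \<Rightarrow> ('p, 'v) garden \<Rightarrow> bool" where
  "respects_arity_flower ar (Atom p xs) \<longleftrightarrow> length xs = ar p"
| "respects_arity_flower ar (\<gamma> \<rhd> \<Delta>) \<longleftrightarrow>
     respects_arity_garden ar \<gamma> \<and> (\<forall>b \<in># image_mset (respects_arity_garden ar) \<Delta>. b)"
| "respects_arity_garden ar (x \<cdot> \<Phi>) \<longleftrightarrow> (\<forall>b \<in># image_mset (respects_arity_flower ar) \<Phi>. b)"

definition respects_arity :: "('p \<Rightarrow> nat) \<Rightarrow> ('p, 'v) bouquet \<Rightarrow> bool" where
  "respects_arity ar \<Phi> \<longleftrightarrow> (\<forall>\<phi> \<in># \<Phi>. respects_arity_flower ar \<phi>)"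


subsection \<open>Free and bound variables\<close>

primrec fv_flower :: "('p, 'v) flower \<Rightarrow> 'v set"
  and fv_garden :: "('p, 'v) garden \<Rightarrow> 'v set" where
  "fv_flower (Atom p xs) = set xs"
| "fv_flower (\<gamma> \<rhd> \<Delta>) =
     fv_garden \<gamma> \<union> (\<Union>(set_mset (image_mset fv_garden \<Delta>)) - fset (sprinkler \<gamma>))"
| "fv_garden (x \<cdot> \<Phi>) = \<Union>(set_mset (image_mset fv_flower \<Phi>)) - fset x"

definition fv :: "('p, 'v) bouquet \<Rightarrow> 'v set" where
  "fv \<Phi> = (\<Union>\<phi> \<in> set_mset \<Phi>. fv_flower \<phi>)"

lemma fv_garden_eq: "fv_garden (x \<cdot> \<Phi>) = fv \<Phi> - fset x"
  by (simp add: fv_def)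

lemma fv_flower_eq:
  "fv_flower ((x \<cdot> \<Phi>) \<rhd> \<Delta>) =
     fv_garden (x \<cdot> \<Phi>) \<union>
     (\<Union>\<delta> \<in> set_mset \<Delta>. fv_garden ((x |\<union>| sprinkler \<delta>) \<cdot> garden_bouquet \<delta>))"
proof -
  have "fv_garden ((x |\<union>| sprinkler \<delta>) \<cdot> garden_bouquet \<delta>) = fv_garden \<delta> - fset x"
    for \<delta>
    by (cases \<delta>) auto
  then show ?thesis by auto
qed

primrec bv_flower :: "('p, 'v) flower \<Rightarrow> 'v set"
  and bv_garden :: "('p, 'v) garden \<Rightarrow> 'v set" where
  "bv_flower (Atom p xs) = {}"
| "bv_flower (\<gamma> \<rhd> \<Delta>) = bv_garden \<gamma> \<union> \<Union>(set_mset (image_mset bv_garden \<Delta>))"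
| "bv_garden (x \<cdot> \<Phi>) = fset x \<union> \<Union>(set_mset (image_mset bv_flower \<Phi>))"

definition bv :: "('p, 'v) bouquet \<Rightarrow> 'v set" where
  "bv \<Phi> = (\<Union>\<phi> \<in> set_mset \<Phi>. bv_flower \<phi>)"

text \<open>The binders counted with multiplicity: one occurrence of a variable for each sprinkler
  containing it.\<close>

primrec binders_flower :: "('p, 'v) flower \<Rightarrow> 'v multiset"
  and binders_garden :: "('p, 'v) garden \<Rightarrow> 'v multiset" where
  "binders_flower (Atom p xs) = {#}"
| "binders_flower (\<gamma> \<rhd> \<Delta>) = binders_garden \<gamma> + \<Sum>\<^sub># (image_mset binders_garden \<Delta>)"
| "binders_garden (x \<cdot> \<Phi>) = mset_set (fset x) + \<Sum>\<^sub># (image_mset binders_flower \<Phi>)"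

definition binders :: "('p, 'v) bouquet \<Rightarrow> 'v multiset" where
  "binders \<Phi> = \<Sum>\<^sub># (image_mset binders_flower \<Phi>)"

definition var_convention :: "('p, 'v) bouquet \<Rightarrow> bool" where
  "var_convention \<Phi> \<longleftrightarrow> (\<forall>v. count (binders \<Phi>) v \<le> 1) \<and> bv \<Phi> \<inter> fv \<Phi> = {}"

definition is_bouquet :: "('p \<Rightarrow> nat) \<Rightarrow> ('p, 'v) bouquet \<Rightarrow> bool" where
  "is_bouquet ar \<Phi> \<longleftrightarrow> respects_arity ar \<Phi> \<and> var_convention \<Phi>"


subsection \<open>Substitutions\<close>

definition has_support :: "('v \<Rightarrow> 'v) \<Rightarrow> 'v fset \<Rightarrow> bool" where
  "has_support \<sigma> y \<longleftrightarrow> {v. \<sigma> v \<noteq> v} = fset y"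

definition subst_minus :: "('v \<Rightarrow> 'v) \<Rightarrow> 'v fset \<Rightarrow> 'v \<Rightarrow> 'v" where
  "subst_minus \<sigma> x = (\<lambda>v. if v |\<in>| x then v else \<sigma> v)"

primrec subst_flower :: "('v \<Rightarrow> 'v) \<Rightarrow> ('p, 'v) flower \<Rightarrow> ('p, 'v) flower"
  and subst_garden :: "('v \<Rightarrow> 'v) \<Rightarrow> ('p, 'v) garden \<Rightarrow> ('p, 'v) garden" where
  "subst_flower \<sigma> (Atom p xs) = Atom p (map \<sigma> xs)"
| "subst_flower \<sigma> (\<gamma> \<rhd> \<Delta>) =
     subst_garden \<sigma> \<gamma> \<rhd> image_mset (subst_garden (subst_minus \<sigma> (sprinkler \<gamma>))) \<Delta>"
| "subst_garden \<sigma> (x \<cdot> \<Phi>) = x \<cdot> image_mset (subst_flower (subst_minus \<sigma> x)) \<Phi>"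

abbreviation subst :: "('v \<Rightarrow> 'v) \<Rightarrow> ('p, 'v) bouquet \<Rightarrow> ('p, 'v) bouquet" where
  "subst \<sigma> \<equiv> image_mset (subst_flower \<sigma>)"

abbreviation subst_corolla :: "('v \<Rightarrow> 'v) \<Rightarrow> ('p, 'v) corolla \<Rightarrow> ('p, 'v) corolla" where
  "subst_corolla \<sigma> \<equiv> image_mset (subst_garden \<sigma>)"

definition capture_avoiding :: "('v \<Rightarrow> 'v) \<Rightarrow> 'v fset \<Rightarrow> ('p, 'v) bouquet \<Rightarrow> bool" where
  "capture_avoiding \<sigma> y \<Phi> \<longleftrightarrow> has_support \<sigma> y \<and> \<sigma> ` fset y \<inter> bv \<Phi> = {}"


subsection \<open>Contexts\<close>

datatype ('p, 'v) bctx =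
    Beside "('p, 'v) bouquet" "('p, 'v) fctx"
and ('p, 'v) fctx =
    Hole
  | In_Pistil "'v fset" "('p, 'v) bctx" "('p, 'v) corolla"
  | In_Petal "('p, 'v) garden" "'v fset" "('p, 'v) bctx" "('p, 'v) corolla"

primrec fill :: "('p, 'v) bctx \<Rightarrow> ('p, 'v) bouquet \<Rightarrow> ('p, 'v) bouquet"
  and fill_fctx :: "('p, 'v) fctx \<Rightarrow> ('p, 'v) bouquet \<Rightarrow> ('p, 'v) bouquet" where
  "fill (Beside \<Psi> \<xi>) \<Theta> = \<Psi> + fill_fctx \<xi> \<Theta>"
| "fill_fctx Hole \<Theta> = \<Theta>"
| "fill_fctx (In_Pistil x \<Xi> \<Delta>) \<Theta> = {# (x \<cdot> fill \<Xi> \<Theta>) \<rhd> \<Delta> #}"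
| "fill_fctx (In_Petal \<gamma> x \<Xi> \<Delta>) \<Theta> = {# \<gamma> \<rhd> add_mset (x \<cdot> fill \<Xi> \<Theta>) \<Delta> #}"

primrec beside :: "('p, 'v) bouquet \<Rightarrow> ('p, 'v) bctx \<Rightarrow> ('p, 'v) bctx" where
  "beside \<Psi> (Beside \<Psi>' \<xi>) = Beside (\<Psi> + \<Psi>') \<xi>"

primrec ctx_comp :: "('p, 'v) bctx \<Rightarrow> ('p, 'v) bctx \<Rightarrow> ('p, 'v) bctx"
  and ctx_comp_fctx :: "('p, 'v) fctx \<Rightarrow> ('p, 'v) bctx \<Rightarrow> ('p, 'v) bctx" where
  "ctx_comp (Beside \<Psi> \<xi>) \<Xi>' = beside \<Psi> (ctx_comp_fctx \<xi> \<Xi>')"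
| "ctx_comp_fctx Hole \<Xi>' = \<Xi>'"
| "ctx_comp_fctx (In_Pistil x \<Xi> \<Delta>) \<Xi>' = Beside {#} (In_Pistil x (ctx_comp \<Xi> \<Xi>') \<Delta>)"
| "ctx_comp_fctx (In_Petal \<gamma> x \<Xi> \<Delta>) \<Xi>' = Beside {#} (In_Petal \<gamma> x (ctx_comp \<Xi> \<Xi>') \<Delta>)"

primrec inversions :: "('p, 'v) bctx \<Rightarrow> nat"
  and inversions_fctx :: "('p, 'v) fctx \<Rightarrow> nat" where
  "inversions (Beside \<Psi> \<xi>) = inversions_fctx \<xi>"
| "inversions_fctx Hole = 0"
| "inversions_fctx (In_Pistil x \<Xi> \<Delta>) = 1 + inversions \<Xi>"
| "inversions_fctx (In_Petal \<gamma> x \<Xi> \<Delta>) = inversions \<Xi>"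

abbreviation positive :: "('p, 'v) bctx \<Rightarrow> bool" where
  "positive \<Xi> \<equiv> even (inversions \<Xi>)"

abbreviation negative :: "('p, 'v) bctx \<Rightarrow> bool" where
  "negative \<Xi> \<equiv> odd (inversions \<Xi>)"


subsection \<open>Renaming of binders\<close>

text \<open>The variable convention is Barendregt's: bouquets that differ only in the names of their
  binders are identified. A bijection \<^term>\<open>\<pi>\<close> of the variables acts on every variable
  occurrence of a flower, binders included, by \<^term>\<open>map_flower id \<pi>\<close>; this is a renaming of
  binders when \<^term>\<open>\<pi>\<close> fixes the free variables. The second rule is for the sprinkler of a
  petal, whose scope is that petal only, so that variables bound by the pistil of the flower
  count as free in it.\<close>

inductive rename_step :: "('p, 'v) bouquet \<Rightarrow> ('p, 'v) bouquet \<Rightarrow> bool" where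
  rename_flower: "\<lbrakk>bij \<pi>; \<forall>v \<in> fv_flower \<phi>. \<pi> v = v\<rbrakk> \<Longrightarrow>
    rename_step (fill \<Xi> {# \<phi> #}) (fill \<Xi> {# map_flower id \<pi> \<phi> #})"
| rename_petal: "\<lbrakk>bij \<pi>; \<forall>v \<in> fv_garden \<delta>. \<pi> v = v\<rbrakk> \<Longrightarrow>
    rename_step (fill \<Xi> {# \<gamma> \<rhd> add_mset \<delta> \<Delta> #})
                (fill \<Xi> {# \<gamma> \<rhd> add_mset (map_garden id \<pi> \<delta>) \<Delta> #})"

definition alpha_eq :: "('p, 'v) bouquet \<Rightarrow> ('p, 'v) bouquet \<Rightarrow> bool"  (infix \<open>\<approx>\<close> 50) where
  "alpha_eq = equivclp rename_step"


subsection \<open>Rules\<close>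

text \<open>Membership of \<^term>\<open>\<phi>\<close> in the pollinating bouquet \<^term>\<open>\<Psi>\<close> is up to renaming of
  binders: with pairwise distinct binders, two copies of a flower that has binders are
  never literally equal.\<close>

definition pollinated_flower :: "('p, 'v) flower \<Rightarrow> ('p, 'v) bctx \<Rightarrow> bool" where
  "pollinated_flower \<phi> \<Xi> \<longleftrightarrow>
     (\<exists>\<Psi> \<Xi>' \<Xi>\<^sub>0. (\<exists>\<psi> \<in># \<Psi>. {# \<psi> #} \<approx> {# \<phi> #}) \<and>
        (\<Xi> = ctx_comp \<Xi>' (beside \<Psi> \<Xi>\<^sub>0) \<or>
         (\<exists>x y \<Delta>. \<Xi> = ctx_comp \<Xi>' (Beside {#} (In_Petal (x \<cdot> \<Psi>) y \<Xi>\<^sub>0 \<Delta>)))))"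

definition pollinated :: "('p, 'v) bouquet \<Rightarrow> ('p, 'v) bctx \<Rightarrow> bool" where
  "pollinated \<Phi> \<Xi> \<longleftrightarrow> (\<forall>\<phi> \<in># \<Phi>. pollinated_flower \<phi> \<Xi>)"

inductive natural_rule :: "('p, 'v) bouquet \<Rightarrow> ('p, 'v) bouquet \<Rightarrow> bool" where
  poll_down: "pollinated \<Phi> \<Xi> \<Longrightarrow> natural_rule (fill \<Xi> \<Phi>) (fill \<Xi> {#})"
| poll_up: "pollinated \<Phi> \<Xi> \<Longrightarrow> natural_rule (fill \<Xi> {#}) (fill \<Xi> \<Phi>)"
| epis: "natural_rule \<Phi> {# ({||} \<cdot> {#}) \<rhd> {# {||} \<cdot> \<Phi> #} #}"
| epet: "natural_rule {# \<gamma> \<rhd> add_mset ({||} \<cdot> {#}) \<Delta> #} {#}"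
| srep: "natural_rule
    {# (x \<cdot> (\<Phi> + {# ({||} \<cdot> {#}) \<rhd> \<Gamma> #})) \<rhd> \<Delta> #}
    {# (x \<cdot> \<Phi>) \<rhd> {# {||} \<cdot> image_mset (\<lambda>\<gamma>. \<gamma> \<rhd> \<Delta>) \<Gamma> #} #}"
| ipis: "capture_avoiding \<sigma> y {# ({||} \<cdot> \<Phi>) \<rhd> \<Delta> #} \<Longrightarrow> natural_rule
    {# ((x |\<union>| y) \<cdot> \<Phi>) \<rhd> \<Delta> #}
    {# (x \<cdot> subst \<sigma> \<Phi>) \<rhd> subst_corolla \<sigma> \<Delta>, ((x |\<union>| y) \<cdot> \<Phi>) \<rhd> \<Delta> #}"
| ipet: "capture_avoiding \<sigma> y \<Phi> \<Longrightarrow> natural_rule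
    {# \<gamma> \<rhd> add_mset ((x |\<union>| y) \<cdot> \<Phi>) \<Delta> #}
    {# \<gamma> \<rhd> add_mset (x \<cdot> subst \<sigma> \<Phi>) (add_mset ((x |\<union>| y) \<cdot> \<Phi>) \<Delta>) #}"

inductive natural_step :: "('p, 'v) bouquet \<Rightarrow> ('p, 'v) bouquet \<Rightarrow> bool" where
  "natural_rule \<Phi> \<Psi> \<Longrightarrow> natural_step (fill \<Xi> \<Phi>) (fill \<Xi> \<Psi>)"

inductive cultural_step :: "('p, 'v) bouquet \<Rightarrow> ('p, 'v) bouquet \<Rightarrow> bool" where
  grow: "positive \<Xi> \<Longrightarrow> cultural_step (fill \<Xi> {#}) (fill \<Xi> \<Phi>)"
| crop: "negative \<Xi> \<Longrightarrow> cultural_step (fill \<Xi> \<Phi>) (fill \<Xi> {#})"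
| pull: "positive \<Xi> \<Longrightarrow> cultural_step (fill \<Xi> {# \<gamma> \<rhd> (\<Gamma> + \<Delta>) #}) (fill \<Xi> {# \<gamma> \<rhd> \<Delta> #})"
| glue: "negative \<Xi> \<Longrightarrow> cultural_step (fill \<Xi> {# \<gamma> \<rhd> \<Delta> #}) (fill \<Xi> {# \<gamma> \<rhd> (\<Gamma> + \<Delta>) #})"
| apis: "\<lbrakk>positive \<Xi>; capture_avoiding \<sigma> y {# ({||} \<cdot> \<Phi>) \<rhd> \<Delta> #}\<rbrakk> \<Longrightarrow> cultural_step
    (fill \<Xi> {# (x \<cdot> subst \<sigma> \<Phi>) \<rhd> subst_corolla \<sigma> \<Delta> #})
    (fill \<Xi> {# ((x |\<union>| y) \<cdot> \<Phi>) \<rhd> \<Delta> #})"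
| apet: "\<lbrakk>negative \<Xi>; capture_avoiding \<sigma> y \<Phi>\<rbrakk> \<Longrightarrow> cultural_step
    (fill \<Xi> {# \<gamma> \<rhd> add_mset (x \<cdot> subst \<sigma> \<Phi>) \<Delta> #})
    (fill \<Xi> {# \<gamma> \<rhd> add_mset ((x |\<union>| y) \<cdot> \<Phi>) \<Delta> #})"


subsection \<open>Derivability\<close>

text \<open>A step for a set of rules, between bouquets taken up to renaming of binders. The conclusion
  to which the rule is applied satisfies the variable convention, also with respect to the free
  variables of the premiss, and this is what keeps pollination and \<open>srep\<close>
  from capturing variables. Distinctness of binders cannot be asked of the literal premiss,
  because some rules duplicate flowers; it is restored by the renaming before the next step.\<close>

definition step ::
  "('p \<Rightarrow> nat) \<Rightarrow> (('p, 'v) bouquet \<Rightarrow> ('p, 'v) bouquet \<Rightarrow> bool)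
    \<Rightarrow> ('p, 'v) bouquet \<Rightarrow> ('p, 'v) bouquet \<Rightarrow> bool" where
  "step ar R \<Phi> \<Psi> \<longleftrightarrow>
     (\<exists>\<Phi>' \<Psi>'. \<Phi> \<approx> \<Phi>' \<and> \<Psi>' \<approx> \<Psi> \<and> R \<Phi>' \<Psi>' \<and>
        is_bouquet ar \<Phi>' \<and> respects_arity ar \<Psi>' \<and> bv \<Phi>' \<inter> fv \<Psi>' = {})"

definition derives ::
  "('p \<Rightarrow> nat) \<Rightarrow> (('p, 'v) bouquet \<Rightarrow> ('p, 'v) bouquet \<Rightarrow> bool)
    \<Rightarrow> ('p, 'v) bouquet \<Rightarrow> ('p, 'v) bouquet \<Rightarrow> bool" where
  "derives ar R = (\<lambda>\<Phi> \<Psi>. \<Phi> \<approx> \<Psi> \<or> step ar R \<Phi> \<Psi>)\<^sup>*\<^sup>*"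

abbreviation full_step :: "('p, 'v) bouquet \<Rightarrow> ('p, 'v) bouquet \<Rightarrow> bool" where
  "full_step \<equiv> sup natural_step cultural_step"

end

theory Submission
  imports Defs
begin

text \<open>If \<^term>\<open>\<Phi>\<close> derives \<^term>\<open>\<Psi>\<close>, run that derivation in the petal of
  \<^term>\<open>bouquet_flower \<Psi> \<Phi>\<close>, a positive context; the petal becomes a copy of the pistil, which
  pollination erases, and the flower vanishes by \<open>epet\<close>. Conversely, \<open>epis\<close>, \<open>grow\<close> and
  \<open>poll_up\<close> turn \<^term>\<open>\<Phi>\<close> into \<^term>\<open>bouquet_flower \<Psi> \<Phi>\<close> beside \<^term>\<open>\<Psi>\<close>, and the given
  derivation erases the flower. The remaining issue is the variable convention: a derivation can
  be run inside a context because the rules commute with bijections of the variables, and the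
  side condition of \<^term>\<open>step\<close> on the free variables of the premiss makes it possible to move
  the binders of a step away from the context while fixing the free variables of both of its
  sides.\<close>

text \<open>The identity is spelled \<^term>\<open>\<lambda>p. p\<close> because this is the form that rewriting with the
  congruence rules of the map functions leaves in place of \<^const>\<open>id\<close>.\<close>

abbreviation flower_rename :: "('v \<Rightarrow> 'v) \<Rightarrow> ('p, 'v) flower \<Rightarrow> ('p, 'v) flower" where
  "flower_rename \<equiv> map_flower (\<lambda>p. p)"

abbreviation garden_rename :: "('v \<Rightarrow> 'v) \<Rightarrow> ('p, 'v) garden \<Rightarrow> ('p, 'v) garden" where
  "garden_rename \<equiv> map_garden (\<lambda>p. p)"

abbreviation ctx_rename :: "('v \<Rightarrow> 'v) \<Rightarrow> ('p, 'v) bctx \<Rightarrow> ('p, 'v) bctx" where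
  "ctx_rename \<equiv> map_bctx (\<lambda>p. p)"

abbreviation fctx_rename :: "('v \<Rightarrow> 'v) \<Rightarrow> ('p, 'v) fctx \<Rightarrow> ('p, 'v) fctx" where
  "fctx_rename \<equiv> map_fctx (\<lambda>p. p)"

abbreviation rename :: "('v \<Rightarrow> 'v) \<Rightarrow> ('p, 'v) bouquet \<Rightarrow> ('p, 'v) bouquet" where
  "rename \<pi> \<equiv> image_mset (flower_rename \<pi>)"


subsection \<open>Contexts\<close>

lemma fill_beside [simp]: "fill (beside \<Psi> \<Xi>) \<Theta> = \<Psi> + fill \<Xi> \<Theta>"
  by (cases \<Xi>) simp

lemma inversions_beside [simp]: "inversions (beside \<Psi> \<Xi>) = inversions \<Xi>"
  by (cases \<Xi>) simp

lemma fill_ctx_comp: "fill (ctx_comp \<Xi> \<Xi>') \<Theta> = fill \<Xi> (fill \<Xi>' \<Theta>)"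
  and "fill (ctx_comp_fctx \<xi> \<Xi>') \<Theta> = fill_fctx \<xi> (fill \<Xi>' \<Theta>)"
  by (induction \<Xi> and \<xi>) auto

lemma
  fixes \<Xi> :: "('p, 'v) bctx" and \<xi> :: "('p, 'v) fctx"
  shows inversions_ctx_comp: "inversions (ctx_comp \<Xi> \<Xi>') = inversions \<Xi> + inversions \<Xi>'"
    and "inversions (ctx_comp_fctx \<xi> \<Xi>') = inversions_fctx \<xi> + inversions \<Xi>'"
  by (induction \<Xi> and \<xi>) auto

lemma natural_step_fill:
  assumes "natural_step \<Phi> \<Psi>"
  shows "natural_step (fill \<Xi> \<Phi>) (fill \<Xi> \<Psi>)"
  using assms by cases (auto simp flip: fill_ctx_comp intro: natural_step.intros)

text \<open>Inversions add up under composition of contexts, so an outer context that is positive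
  leaves the parity demanded by each cultural rule unchanged.\<close>

lemma cultural_step_fill:
  assumes "cultural_step \<Phi> \<Psi>" "positive \<Xi>"
  shows "cultural_step (fill \<Xi> \<Phi>) (fill \<Xi> \<Psi>)"
  using assms
  by (cases; simp flip: fill_ctx_comp)
     (auto intro!: cultural_step.intros simp: inversions_ctx_comp)

lemma full_step_fill:
  assumes "full_step \<Phi> \<Psi>" "positive \<Xi>"
  shows "full_step (fill \<Xi> \<Phi>) (fill \<Xi> \<Psi>)"
  using assms natural_step_fill[of \<Phi> \<Psi> \<Xi>] cultural_step_fill[of \<Phi> \<Psi> \<Xi>] by auto

lemma rename_step_fill:
  assumes "rename_step \<Phi> \<Psi>"
  shows "rename_step (fill \<Xi> \<Phi>) (fill \<Xi> \<Psi>)"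
  using assms by cases (auto simp flip: fill_ctx_comp intro: rename_step.intros)


subsection \<open>Renaming of binders\<close>

lemma alpha_eq_refl [simp]: "\<Phi> \<approx> \<Phi>"
  by (simp add: alpha_eq_def)

lemma alpha_eq_sym: "\<Phi> \<approx> \<Psi> \<Longrightarrow> \<Psi> \<approx> \<Phi>"
  unfolding alpha_eq_def by (rule equivclp_sym)

lemma alpha_eq_trans [trans]: "\<Phi> \<approx> \<Psi> \<Longrightarrow> \<Psi> \<approx> \<Theta> \<Longrightarrow> \<Phi> \<approx> \<Theta>"
  unfolding alpha_eq_def by (rule equivclp_trans)

text \<open>Used with \<open>f\<close> equal to \<open>fill \<Xi>\<close> and to
  \<open>rename \<pi>\<close>: it reduces compatibility with renaming of binders to a single
  \<open>rename_step\<close>.\<close>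

lemma alpha_eq_map:
  assumes "\<And>\<Phi> \<Psi>. rename_step \<Phi> \<Psi> \<Longrightarrow> rename_step (f \<Phi>) (f \<Psi>)" and "\<Phi> \<approx> \<Psi>"
  shows "f \<Phi> \<approx> f \<Psi>"
  using assms(2) unfolding alpha_eq_def
proof (induction rule: equivclp_induct)
  case base
  show ?case by simp
next
  case (step \<Psi> \<Theta>)
  \<comment> \<open>The link from \<open>\<Psi>\<close> to \<open>\<Theta>\<close> may be a renaming
    step in either direction; symmetry of the closure covers the backward one.\<close>
  then have "equivclp rename_step (f \<Psi>) (f \<Theta>)"
    using assms(1) by (blast intro: r_into_equivclp equivclp_sym)
  with step.IH show ?case by (rule equivclp_trans)
qed

lemma alpha_eq_fill: "\<Phi> \<approx> \<Psi> \<Longrightarrow> fill \<Xi> \<Phi> \<approx> fill \<Xi> \<Psi>"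
  using alpha_eq_map[of "fill \<Xi>"] rename_step_fill by blast

lemma alpha_eq_union_left: "\<Phi> \<approx> \<Psi> \<Longrightarrow> \<Theta> + \<Phi> \<approx> \<Theta> + \<Psi>"
  using alpha_eq_fill[of \<Phi> \<Psi> "Beside \<Theta> Hole"] by simp

lemma alpha_eq_union: "\<Phi> \<approx> \<Phi>' \<Longrightarrow> \<Psi> \<approx> \<Psi>' \<Longrightarrow> \<Phi> + \<Psi> \<approx> \<Phi>' + \<Psi>'"
  by (metis alpha_eq_trans alpha_eq_union_left union_commute)

lemma alpha_eq_bouquet_flower:
  assumes "\<Phi> \<approx> \<Phi>'" "\<Psi> \<approx> \<Psi>'"
  shows "{# bouquet_flower \<Psi> \<Phi> #} \<approx> {# bouquet_flower \<Psi>' \<Phi>' #}"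
proof -
  have "{# bouquet_flower \<Psi> \<Phi> #} \<approx> {# bouquet_flower \<Psi> \<Phi>' #}"
    using alpha_eq_fill[OF assms(1),
        of "Beside {#} (In_Petal ({||} \<cdot> \<Psi>) {||} (Beside {#} Hole) {#})"] by simp
  also have "{# bouquet_flower \<Psi> \<Phi>' #} \<approx> {# bouquet_flower \<Psi>' \<Phi>' #}"
    using alpha_eq_fill[OF assms(2),
        of "Beside {#} (In_Pistil {||} (Beside {#} Hole) {# {||} \<cdot> \<Phi>' #})"] by simp
  finally show ?thesis .
qed

text \<open>The bijection is applied to one flower at a time. Since it fixes the free variables of
  the whole bouquet, it fixes those of each flower, and every such change is an instance of
  \<open>rename_flower\<close>.\<close>

lemma rename_alpha_eq:
  assumes "bij \<pi>" "\<forall>v \<in> fv \<Phi>. \<pi> v = v"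
  shows "\<Phi> \<approx> rename \<pi> \<Phi>"
  using assms(2)
proof (induction \<Phi>)
  case empty
  show ?case by simp
next
  case (add \<phi> \<Phi>)
  have "rename_step {# \<phi> #} {# flower_rename \<pi> \<phi> #}"
    using rename_flower[of \<pi> \<phi> "Beside {#} Hole", unfolded id_def] assms(1) add.prems by (simp add: fv_def)
  then have "{# \<phi> #} \<approx> {# flower_rename \<pi> \<phi> #}"
    unfolding alpha_eq_def by blast
  moreover have "\<Phi> \<approx> rename \<pi> \<Phi>"
    using add.prems by (intro add.IH) (simp add: fv_def)
  ultimately show ?case
    using alpha_eq_union by fastforce
qed


subsection \<open>Commutation with bijections of the variables\<close>

text \<open>Injectivity lets the image under \<open>\<pi>\<close> commute with the removal of the
  variables of a sprinkler.\<close>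

lemma
  fixes \<phi> :: "('p, 'v) flower" and \<delta> :: "('p, 'v) garden"
  assumes "inj \<pi>"
  shows fv_map_flower: "fv_flower (flower_rename \<pi> \<phi>) = \<pi> ` fv_flower \<phi>"
    and fv_map_garden: "fv_garden (garden_rename \<pi> \<delta>) = \<pi> ` fv_garden \<delta>"
proof (induction \<phi> and \<delta>)
  case (Flower \<gamma> \<Delta>)
  then show ?case
    \<comment> \<open>Splitting the pistil exposes its sprinkler, which also binds in the
      petals.\<close>
    by (cases \<gamma>) (simp add: assms image_Un image_UN image_set_diff image_image)
qed (simp_all add: assms image_UN image_set_diff image_image)

lemma fv_rename: "inj \<pi> \<Longrightarrow> fv (rename \<pi> \<Phi>) = \<pi> ` fv \<Phi>"
  by (simp add: fv_def fv_map_flower image_UN)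

lemma image_mset_sum_mset: "image_mset f (\<Sum>\<^sub># M) = \<Sum>\<^sub># (image_mset (image_mset f) M)"
  by (induction M) simp_all

lemma
  fixes \<phi> :: "('p, 'v) flower" and \<delta> :: "('p, 'v) garden"
  assumes "inj \<pi>"
  shows binders_map_flower: "binders_flower (flower_rename \<pi> \<phi>) = image_mset \<pi> (binders_flower \<phi>)"
    and "binders_garden (garden_rename \<pi> \<delta>) = image_mset \<pi> (binders_garden \<delta>)"
proof (induction \<phi> and \<delta>)
  case (Flower \<gamma> \<Delta>)
  have "image_mset (binders_garden \<circ> garden_rename \<pi>) \<Delta>
      = image_mset (image_mset \<pi> \<circ> binders_garden) \<Delta>"
    using Flower by (intro image_mset_cong) simp
  with Flower show ?case by (simp add: multiset.map_comp image_mset_sum_mset)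
next
  case (Garden x \<Phi>)
  have "image_mset (binders_flower \<circ> flower_rename \<pi>) \<Phi>
      = image_mset (image_mset \<pi> \<circ> binders_flower) \<Phi>"
    using Garden by (intro image_mset_cong) simp
  with Garden show ?case
    by (simp add: multiset.map_comp image_mset_sum_mset image_mset_mset_set
        inj_on_subset[OF assms])
qed simp_all

lemma binders_rename:
  assumes "inj \<pi>"
  shows "binders (rename \<pi> \<Phi>) = image_mset \<pi> (binders \<Phi>)"
  by (induction \<Phi>) (simp_all add: binders_def binders_map_flower assms)

text \<open>Forgetting multiplicities turns \<open>binders\<close> into \<open>bv\<close>.
  Finiteness of \<open>bv\<close> and its values on renamed and compound bouquets are then read off
  from the facts about \<open>binders\<close>.\<close>

lemma
  fixes \<phi> :: "('p, 'v) flower" and \<delta> :: "('p, 'v) garden"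
  shows set_mset_binders_flower: "set_mset (binders_flower \<phi>) = bv_flower \<phi>"
    and "set_mset (binders_garden \<delta>) = bv_garden \<delta>"
  by (induction \<phi> and \<delta>) auto

lemma set_mset_binders: "set_mset (binders \<Phi>) = bv \<Phi>"
  by (simp add: binders_def bv_def set_mset_binders_flower)

lemma finite_bv: "finite (bv \<Phi>)"
  by (simp flip: set_mset_binders)

lemma
  fixes \<phi> :: "('p, 'v) flower" and \<delta> :: "('p, 'v) garden"
  shows finite_fv_flower: "finite (fv_flower \<phi>)"
    and "finite (fv_garden \<delta>)"
  by (induction \<phi> and \<delta>) auto

lemma finite_fv: "finite (fv \<Phi>)"
  by (simp add: fv_def finite_fv_flower)

lemma bv_rename: "inj \<pi> \<Longrightarrow> bv (rename \<pi> \<Phi>) = \<pi> ` bv \<Phi>"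
  by (simp add: binders_rename flip: set_mset_binders)

lemma
  fixes \<phi> :: "('p, 'v) flower" and \<delta> :: "('p, 'v) garden"
  shows respects_arity_map_flower: "respects_arity_flower ar (flower_rename \<pi> \<phi>) = respects_arity_flower ar \<phi>"
    and "respects_arity_garden ar (garden_rename \<pi> \<delta>) = respects_arity_garden ar \<delta>"
  by (induction \<phi> and \<delta>) auto

lemma respects_arity_rename: "respects_arity ar (rename \<pi> \<Phi>) = respects_arity ar \<Phi>"
  by (simp add: respects_arity_def respects_arity_map_flower)

lemma count_image_mset_inj:
  assumes "inj f"
  shows "count (image_mset f M) (f a) = count M a"
  using assms by (induction M) (auto simp: inj_eq)

lemma distinct_binders_rename:
  assumes "bij \<pi>" "\<forall>v. count (binders \<Phi>) v \<le> 1"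
  shows "count (binders (rename \<pi> \<Phi>)) v \<le> 1"
proof -
  obtain u where "v = \<pi> u" using assms(1) by (metis bij_pointE)
  then show ?thesis
    using assms by (simp add: binders_rename bij_is_inj count_image_mset_inj)
qed

section \<open>Bijections acting on contexts\<close>

lemma fill_rename:
    "fill (ctx_rename \<pi> \<Xi>) (rename \<pi> \<Theta>) = rename \<pi> (fill \<Xi> \<Theta>)"
  and "fill_fctx (fctx_rename \<pi> \<xi>) (rename \<pi> \<Theta>) = rename \<pi> (fill_fctx \<xi> \<Theta>)"
  by (induction \<Xi> and \<xi>) auto

lemma
  fixes \<Xi> :: "('p, 'v) bctx" and \<xi> :: "('p, 'v) fctx"
  shows inversions_map_bctx [simp]: "inversions (ctx_rename \<pi> \<Xi>) = inversions \<Xi>"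
    and "inversions_fctx (fctx_rename \<pi> \<xi>) = inversions_fctx \<xi>"
  by (induction \<Xi> and \<xi>) auto

lemma map_beside: "ctx_rename \<pi> (beside \<Psi> \<Xi>) = beside (rename \<pi> \<Psi>) (ctx_rename \<pi> \<Xi>)"
  by (cases \<Xi>) simp

lemma map_ctx_comp:
    "ctx_rename \<pi> (ctx_comp \<Xi> \<Xi>') = ctx_comp (ctx_rename \<pi> \<Xi>) (ctx_rename \<pi> \<Xi>')"
  and "ctx_rename \<pi> (ctx_comp_fctx \<xi> \<Xi>') = ctx_comp_fctx (fctx_rename \<pi> \<xi>) (ctx_rename \<pi> \<Xi>')"
  by (induction \<Xi> and \<xi>) (auto simp: map_beside)

section \<open>Bijections acting on renamings of binders\<close>

lemma conjugate_fixes: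
  assumes "bij \<pi>" "\<forall>v \<in> F. \<rho> v = v"
  shows "\<forall>v \<in> \<pi> ` F. (\<pi> \<circ> \<rho> \<circ> inv \<pi>) v = v"
  using assms by (simp add: bij_is_inj)

text \<open>A renaming \<open>\<rho>\<close> of binders is transported along \<open>\<pi>\<close> by
  conjugation, because the inverse cancels against the \<open>\<pi>\<close> already applied to the
  flower or garden.\<close>

lemma map_conjugate:
  assumes "bij \<pi>"
  shows "flower_rename (\<pi> \<circ> \<rho> \<circ> inv \<pi>) (flower_rename \<pi> \<phi>) = flower_rename \<pi> (flower_rename \<rho> \<phi>)"
    and "garden_rename (\<pi> \<circ> \<rho> \<circ> inv \<pi>) (garden_rename \<pi> \<delta>) = garden_rename \<pi> (garden_rename \<rho> \<delta>)"
proof -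
  have "(\<pi> \<circ> \<rho> \<circ> inv \<pi>) \<circ> \<pi> = \<pi> \<circ> \<rho>"
    using assms by (simp add: fun_eq_iff bij_is_inj)
  then show "flower_rename (\<pi> \<circ> \<rho> \<circ> inv \<pi>) (flower_rename \<pi> \<phi>) = flower_rename \<pi> (flower_rename \<rho> \<phi>)"
    and "garden_rename (\<pi> \<circ> \<rho> \<circ> inv \<pi>) (garden_rename \<pi> \<delta>) = garden_rename \<pi> (garden_rename \<rho> \<delta>)"
    by (simp_all add: flower.map_comp garden.map_comp)
qed

lemma rename_step_rename:
  assumes "bij \<pi>" "rename_step \<Phi> \<Psi>"
  shows "rename_step (rename \<pi> \<Phi>) (rename \<pi> \<Psi>)"
  using assms(2)
proof cases
  case (rename_flower \<rho> \<phi> \<Xi>)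
  let ?\<rho> = "\<pi> \<circ> \<rho> \<circ> inv \<pi>"
  have "bij ?\<rho>"
    using assms(1) rename_flower(3) by (intro bij_comp bij_imp_bij_inv)
  moreover have "\<forall>v \<in> fv_flower (flower_rename \<pi> \<phi>). ?\<rho> v = v"
    unfolding fv_map_flower[OF bij_is_inj[OF assms(1)]]
    by (rule conjugate_fixes[OF assms(1) rename_flower(4)])
  ultimately show ?thesis
    using rename_step.rename_flower[of ?\<rho> "flower_rename \<pi> \<phi>" "ctx_rename \<pi> \<Xi>"]
    unfolding id_def map_conjugate[OF assms(1)] rename_flower(1,2) fill_rename(1)[symmetric] by simp
next
  case (rename_petal \<rho> \<delta> \<Xi> \<gamma> \<Delta>)
  let ?\<rho> = "\<pi> \<circ> \<rho> \<circ> inv \<pi>"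
  have "bij ?\<rho>"
    using assms(1) rename_petal(3) by (intro bij_comp bij_imp_bij_inv)
  moreover have "\<forall>v \<in> fv_garden (garden_rename \<pi> \<delta>). ?\<rho> v = v"
    unfolding fv_map_garden[OF bij_is_inj[OF assms(1)]]
    by (rule conjugate_fixes[OF assms(1) rename_petal(4)])
  ultimately show ?thesis
    using rename_step.rename_petal[of ?\<rho> "garden_rename \<pi> \<delta>" "ctx_rename \<pi> \<Xi>"
        "garden_rename \<pi> \<gamma>" "image_mset (garden_rename \<pi>) \<Delta>"]
    unfolding id_def map_conjugate[OF assms(1)] rename_petal(1,2) fill_rename(1)[symmetric] by simp
qed

lemma alpha_eq_rename: "bij \<pi> \<Longrightarrow> \<Phi> \<approx> \<Psi> \<Longrightarrow> rename \<pi> \<Phi> \<approx> rename \<pi> \<Psi>"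
  using alpha_eq_map[of "rename \<pi>"] rename_step_rename by blast

section \<open>Bijections acting on substitutions\<close>

lemma subst_minus_conjugate:
  assumes "bij \<pi>"
  shows "subst_minus (\<pi> \<circ> \<sigma> \<circ> inv \<pi>) (\<pi> |`| x) = \<pi> \<circ> subst_minus \<sigma> x \<circ> inv \<pi>"
proof
  fix v
  obtain u where "v = \<pi> u"
    using assms by (metis bij_pointE)
  then show "subst_minus (\<pi> \<circ> \<sigma> \<circ> inv \<pi>) (\<pi> |`| x) v = (\<pi> \<circ> subst_minus \<sigma> x \<circ> inv \<pi>) v"
    using assms by (auto simp: subst_minus_def bij_is_inj inj_eq)
qed

text \<open>A substitution is transported by conjugation as well. The induction keeps
  \<open>\<sigma>\<close> arbitrary because it becomes \<open>subst_minus \<sigma> x\<close> under a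
  sprinkler \<open>x\<close>, and conjugation commutes with this restriction.\<close>

lemma
  fixes \<phi> :: "('p, 'v) flower" and \<delta> :: "('p, 'v) garden"
  assumes "bij \<pi>"
  shows map_subst_flower: "flower_rename \<pi> (subst_flower \<sigma> \<phi>)
      = subst_flower (\<pi> \<circ> \<sigma> \<circ> inv \<pi>) (flower_rename \<pi> \<phi>)"
    and map_subst_garden: "garden_rename \<pi> (subst_garden \<sigma> \<delta>)
      = subst_garden (\<pi> \<circ> \<sigma> \<circ> inv \<pi>) (garden_rename \<pi> \<delta>)"
proof (induction \<phi> and \<delta> arbitrary: \<sigma> and \<sigma>)
  case (Atom p xs)
  then show ?case by (simp add: bij_is_inj[OF assms])
next
  case (Flower \<gamma> \<Delta>)
  then show ?case
    by (cases \<gamma>)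
      (auto simp: multiset.map_comp subst_minus_conjugate[OF assms, unfolded comp_def]
        intro!: image_mset_cong)
next
  case (Garden x \<Phi>)
  then show ?case
    by (auto simp: multiset.map_comp subst_minus_conjugate[OF assms, unfolded comp_def]
        intro!: image_mset_cong)
qed

text \<open>The support of the conjugate is the image of the support, and an injective map preserves
  the disjointness of the substituted variables from the binders.\<close>

lemma capture_avoiding_rename:
  assumes "bij \<pi>" "capture_avoiding \<sigma> y \<Phi>"
  shows "capture_avoiding (\<pi> \<circ> \<sigma> \<circ> inv \<pi>) (\<pi> |`| y) (rename \<pi> \<Phi>)"
proof -
  have inj: "inj \<pi>" by (rule bij_is_inj[OF assms(1)])
  have "{v. (\<pi> \<circ> \<sigma> \<circ> inv \<pi>) v \<noteq> v} = \<pi> ` {v. \<sigma> v \<noteq> v}"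
  proof (intro set_eqI)
    fix v
    obtain u where "v = \<pi> u"
      using assms by (metis bij_pointE)
    then show "v \<in> {v. (\<pi> \<circ> \<sigma> \<circ> inv \<pi>) v \<noteq> v} \<longleftrightarrow> v \<in> \<pi> ` {v. \<sigma> v \<noteq> v}"
      using inj by (auto simp: inj_eq)
  qed
  moreover have "(\<pi> \<circ> \<sigma> \<circ> inv \<pi>) ` fset (\<pi> |`| y) = \<pi> ` \<sigma> ` fset y"
    using inj by (auto simp: image_image)
  ultimately show ?thesis
    using assms(2) inj
    by (simp add: capture_avoiding_def has_support_def bv_rename flip: image_Int)
qed

lemma rename_subst:
  "bij \<pi> \<Longrightarrow> rename \<pi> (subst \<sigma> \<Phi>) = subst (\<pi> \<circ> \<sigma> \<circ> inv \<pi>) (rename \<pi> \<Phi>)"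
  by (simp add: multiset.map_comp comp_def map_subst_flower)

lemma rename_subst_corolla:
  "bij \<pi> \<Longrightarrow> image_mset (garden_rename \<pi>) (subst_corolla \<sigma> \<Delta>)
    = subst_corolla (\<pi> \<circ> \<sigma> \<circ> inv \<pi>) (image_mset (garden_rename \<pi>) \<Delta>)"
  by (simp add: multiset.map_comp comp_def map_subst_garden)

section \<open>Bijections acting on pollination and on the rules\<close>

lemma pollinated_rename:
  assumes "bij \<pi>" "pollinated \<Phi> \<Xi>"
  shows "pollinated (rename \<pi> \<Phi>) (ctx_rename \<pi> \<Xi>)"
  unfolding pollinated_def
proof
  fix \<phi>'
  assume "\<phi>' \<in># rename \<pi> \<Phi>"
  then obtain \<phi> where \<phi>: "\<phi> \<in># \<Phi>" "\<phi>' = flower_rename \<pi> \<phi>" by auto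
  with assms(2) obtain \<Psi> \<Xi>' \<Xi>\<^sub>0 \<psi> where \<psi>: "\<psi> \<in># \<Psi>" "{# \<psi> #} \<approx> {# \<phi> #}"
    and \<Xi>: "\<Xi> = ctx_comp \<Xi>' (beside \<Psi> \<Xi>\<^sub>0) \<or>
      (\<exists>x y \<Delta>. \<Xi> = ctx_comp \<Xi>' (Beside {#} (In_Petal (x \<cdot> \<Psi>) y \<Xi>\<^sub>0 \<Delta>)))"
    unfolding pollinated_def pollinated_flower_def by blast
  \<comment> \<open>The pollinating flower equals \<open>\<phi>\<close> only up to renaming of
    binders, so \<open>\<approx>\<close> itself has to be preserved by \<open>\<pi>\<close>.\<close>
  have "\<exists>\<psi>' \<in># rename \<pi> \<Psi>. {# \<psi>' #} \<approx> {# \<phi>' #}"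
    using \<psi> \<phi>(2) alpha_eq_rename[OF assms(1) \<psi>(2)] by auto
  moreover have "ctx_rename \<pi> \<Xi>
        = ctx_comp (ctx_rename \<pi> \<Xi>') (beside (rename \<pi> \<Psi>) (ctx_rename \<pi> \<Xi>\<^sub>0)) \<or>
      (\<exists>x y \<Delta>. ctx_rename \<pi> \<Xi>
        = ctx_comp (ctx_rename \<pi> \<Xi>')
            (Beside {#} (In_Petal (x \<cdot> rename \<pi> \<Psi>) y (ctx_rename \<pi> \<Xi>\<^sub>0) \<Delta>)))"
    using \<Xi> by (elim disjE exE; simp add: map_ctx_comp map_beside; blast)
  ultimately show "pollinated_flower \<phi>' (ctx_rename \<pi> \<Xi>)"
    unfolding pollinated_flower_def by blast
qed

lemma natural_rule_rename:
  assumes "bij \<pi>" "natural_rule \<Phi> \<Psi>"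
  shows "natural_rule (rename \<pi> \<Phi>) (rename \<pi> \<Psi>)"
  using assms(2)
proof cases
  case (poll_down \<Phi> \<Xi>)
  then show ?thesis
    using natural_rule.poll_down[OF pollinated_rename[OF assms(1)], of \<Phi> \<Xi>]
    by (simp flip: fill_rename(1))
next
  case (poll_up \<Phi> \<Xi>)
  then show ?thesis
    using natural_rule.poll_up[OF pollinated_rename[OF assms(1)], of \<Phi> \<Xi>]
    by (simp flip: fill_rename(1))
next
  case epis
  then show ?thesis by (simp add: natural_rule.epis)
next
  case (epet \<gamma> \<Delta>)
  then show ?thesis by (simp add: natural_rule.epet)
next
  case (srep x \<Phi> \<Gamma> \<Delta>)
  then show ?thesis
    using natural_rule.srep[of "\<pi> |`| x" "rename \<pi> \<Phi>" "image_mset (garden_rename \<pi>) \<Gamma>"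
        "image_mset (garden_rename \<pi>) \<Delta>"]
    by (simp add: multiset.map_comp comp_def)
next
  case (ipis \<sigma> y \<Phi> \<Delta> x)
  then show ?thesis
    using natural_rule.ipis[OF capture_avoiding_rename[OF assms(1) ipis(3), simplified],
        of "\<pi> |`| x"]
    by (simp add: fimage_funion rename_subst rename_subst_corolla assms(1))
next
  case (ipet \<sigma> y \<Phi> \<gamma> x \<Delta>)
  then show ?thesis
    using natural_rule.ipet[OF capture_avoiding_rename[OF assms(1) ipet(3)],
        of "garden_rename \<pi> \<gamma>" "\<pi> |`| x" "image_mset (garden_rename \<pi>) \<Delta>"]
    by (simp add: fimage_funion rename_subst assms(1))
qed

lemma natural_step_rename:
  assumes "bij \<pi>" "natural_step \<Phi> \<Psi>"
  shows "natural_step (rename \<pi> \<Phi>) (rename \<pi> \<Psi>)"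
  using assms(2)
  by cases (simp add: natural_step.intros natural_rule_rename[OF assms(1)] flip: fill_rename(1))

lemma cultural_step_rename:
  assumes "bij \<pi>" "cultural_step \<Phi> \<Psi>"
  shows "cultural_step (rename \<pi> \<Phi>) (rename \<pi> \<Psi>)"
  using assms(2)
proof cases
  case (grow \<Xi> \<Phi>)
  then show ?thesis
    using cultural_step.grow[of "ctx_rename \<pi> \<Xi>"] by (simp flip: fill_rename(1))
next
  case (crop \<Xi> \<Phi>)
  then show ?thesis
    using cultural_step.crop[of "ctx_rename \<pi> \<Xi>"] by (simp flip: fill_rename(1))
next
  case (pull \<Xi> \<gamma> \<Gamma> \<Delta>)
  then show ?thesis
    using cultural_step.pull[of "ctx_rename \<pi> \<Xi>"] by (simp flip: fill_rename(1))
next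
  case (glue \<Xi> \<gamma> \<Delta> \<Gamma>)
  then show ?thesis
    using cultural_step.glue[of "ctx_rename \<pi> \<Xi>"] by (simp flip: fill_rename(1))
next
  case (apis \<Xi> \<sigma> y \<Phi> \<Delta> x)
  then show ?thesis
    using cultural_step.apis[OF _ capture_avoiding_rename[OF assms(1) apis(4), simplified],
        of "ctx_rename \<pi> \<Xi>" "\<pi> |`| x"]
    by (simp add: fimage_funion rename_subst rename_subst_corolla assms(1) flip: fill_rename(1))
next
  case (apet \<Xi> \<sigma> y \<Phi> \<gamma> x \<Delta>)
  then show ?thesis
    using cultural_step.apet[OF _ capture_avoiding_rename[OF assms(1) apet(4)],
        of "ctx_rename \<pi> \<Xi>" "garden_rename \<pi> \<gamma>" "\<pi> |`| x" "image_mset (garden_rename \<pi>) \<Delta>"]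
    by (simp add: fimage_funion rename_subst assms(1) flip: fill_rename(1))
qed

lemma full_step_rename:
  "bij \<pi> \<Longrightarrow> full_step \<Phi> \<Psi> \<Longrightarrow> full_step (rename \<pi> \<Phi>) (rename \<pi> \<Psi>)"
  using natural_step_rename[of \<pi> \<Phi> \<Psi>] cultural_step_rename[of \<pi> \<Phi> \<Psi>] by auto


subsection \<open>Derivations in contexts\<close>

lemma fresh_bij:
  fixes B F A :: "'v set"
  assumes "infinite (UNIV :: 'v set)" "finite B" "finite F" "finite A" "B \<inter> F = {}"
  obtains \<pi> where "bij \<pi>" "\<forall>v \<in> F. \<pi> v = v" "\<pi> ` B \<inter> A = {}"
proof -
  have "infinite (- (A \<union> B \<union> F))"
    using assms(1-4) by (simp add: Compl_eq_Diff_UNIV)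
  then obtain C where C: "finite C" "card C = card B" "C \<subseteq> - (A \<union> B \<union> F)"
    using infinite_arbitrarily_large by metis
  then obtain f where f: "bij_betw f B C"
    using assms(2) finite_same_card_bij by metis
  define \<pi> where "\<pi> v = (if v \<in> B then f v else if v \<in> C then inv_into B f v else v)" for v
  \<comment> \<open>An exchange of two disjoint sets is its own inverse; bijectivity follows at
    once.\<close>
  have "\<pi> (\<pi> v) = v" for v
    using f C(3) bij_betw_inv_into_left[OF f] bij_betw_inv_into_right[OF f]
      bij_betwE[OF f] bij_betwE[OF bij_betw_inv_into[OF f]]
    by (auto simp: \<pi>_def)
  then have "bij \<pi>" by (metis bijI')
  moreover have "\<forall>v \<in> F. \<pi> v = v"
    using assms(5) C(3) by (auto simp: \<pi>_def)
  moreover have "\<pi> ` B \<inter> A = {}"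
    using C(3) bij_betwE[OF f] by (auto simp: \<pi>_def)
  ultimately show thesis by (rule that)
qed

text \<open>The binders are moved out of a finite set \<open>A\<close> by a bijection that fixes the
  free variables. The last conclusion compares the two bouquets flower by flower, which is the form
  that pollination asks for.\<close>

lemma fresh_copy:
  fixes \<Phi> :: "('p, 'v) bouquet"
  assumes "infinite (UNIV :: 'v set)" "is_bouquet ar \<Phi>" "finite A"
  obtains \<Phi>' where "\<Phi> \<approx> \<Phi>'" "is_bouquet ar \<Phi>'" "fv \<Phi>' = fv \<Phi>" "bv \<Phi>' \<inter> A = {}"
    "\<And>\<phi>'. \<phi>' \<in># \<Phi>' \<Longrightarrow> \<exists>\<phi> \<in># \<Phi>. {# \<phi> #} \<approx> {# \<phi>' #}"
proof -
  have \<Phi>: "respects_arity ar \<Phi>" "\<forall>v. count (binders \<Phi>) v \<le> 1" "bv \<Phi> \<inter> fv \<Phi> = {}"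
    using assms(2) by (auto simp: is_bouquet_def var_convention_def)
  obtain \<pi> where \<pi>: "bij \<pi>" "\<forall>v \<in> fv \<Phi>. \<pi> v = v" "\<pi> ` bv \<Phi> \<inter> (A \<union> fv \<Phi>) = {}"
    using fresh_bij[OF assms(1) finite_bv finite_fv _ \<Phi>(3)] assms(3) finite_fv finite_UnI by metis
  have inj: "inj \<pi>" by (rule bij_is_inj[OF \<pi>(1)])
  have fv: "fv (rename \<pi> \<Phi>) = fv \<Phi>"
    using \<pi>(2) by (simp add: fv_rename[OF inj])
  have bv: "bv (rename \<pi> \<Phi>) \<inter> (A \<union> fv \<Phi>) = {}"
    using \<pi>(3) by (simp add: bv_rename[OF inj])
  show thesis
  proof
    show "\<Phi> \<approx> rename \<pi> \<Phi>" by (rule rename_alpha_eq[OF \<pi>(1,2)])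
    show "is_bouquet ar (rename \<pi> \<Phi>)"
      using \<Phi>(1) distinct_binders_rename[OF \<pi>(1) \<Phi>(2)] fv bv
      by (auto simp: is_bouquet_def var_convention_def respects_arity_rename)
    show "fv (rename \<pi> \<Phi>) = fv \<Phi>" by (rule fv)
    show "bv (rename \<pi> \<Phi>) \<inter> A = {}" using bv by blast
    show "\<exists>\<phi> \<in># \<Phi>. {# \<phi> #} \<approx> {# \<phi>' #}" if \<phi>': "\<phi>' \<in># rename \<pi> \<Phi>" for \<phi>'
    proof -
      obtain \<phi> where "\<phi> \<in># \<Phi>" "\<phi>' = flower_rename \<pi> \<phi>" using \<phi>' by auto
      moreover have "{# \<phi> #} \<approx> rename \<pi> {# \<phi> #}"
        using \<pi>(2) \<open>\<phi> \<in># \<Phi>\<close> by (intro rename_alpha_eq[OF \<pi>(1)]) (auto simp: fv_def)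
      ultimately show ?thesis by auto
    qed
  qed
qed

section \<open>Variables, binders and arity of compound bouquets\<close>

lemma fv_union [simp]: "fv (\<Phi> + \<Psi>) = fv \<Phi> \<union> fv \<Psi>"
  by (auto simp: fv_def)

lemma binders_union [simp]: "binders (\<Phi> + \<Psi>) = binders \<Phi> + binders \<Psi>"
  by (simp add: binders_def)

lemma respects_arity_union [simp]:
  "respects_arity ar (\<Phi> + \<Psi>) \<longleftrightarrow> respects_arity ar \<Phi> \<and> respects_arity ar \<Psi>"
  by (auto simp: respects_arity_def)

lemma fv_bouquet_flower [simp]: "fv {# bouquet_flower \<Psi> \<Phi> #} = fv \<Psi> \<union> fv \<Phi>"
  by (simp add: fv_def)

lemma binders_bouquet_flower [simp]:
  "binders {# bouquet_flower \<Psi> \<Phi> #} = binders \<Psi> + binders \<Phi>"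
  by (simp add: binders_def)

lemma respects_arity_bouquet_flower [simp]:
  "respects_arity ar {# bouquet_flower \<Psi> \<Phi> #} \<longleftrightarrow> respects_arity ar \<Psi> \<and> respects_arity ar \<Phi>"
  by (auto simp: respects_arity_def)

lemma empty_bouquet [simp]: "fv {#} = {}" "bv {#} = {}" "binders {#} = {#}" "respects_arity ar {#}"
  by (auto simp: fv_def bv_def binders_def respects_arity_def)

lemma bv_union [simp]: "bv (\<Phi> + \<Psi>) = bv \<Phi> \<union> bv \<Psi>"
  by (simp flip: set_mset_binders)

lemma bv_bouquet_flower [simp]: "bv {# bouquet_flower \<Psi> \<Phi> #} = bv \<Psi> \<union> bv \<Phi>"
  by (simp flip: set_mset_binders)

text \<open>\<open>\<Theta>\<close> enters only through its binders, free variables and arities, so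
  the same argument serves for \<open>\<Psi> + \<Phi>\<close>, for
  \<open>bouquet_flower \<Psi> \<Phi>\<close> and for the contexts of \<open>derives_fill\<close>.
  Distinctness holds because no variable is bound in both \<open>\<Psi>\<close> and
  \<open>\<Phi>\<close>.\<close>

lemma is_bouquet_apart:
  assumes "is_bouquet ar \<Psi>" "is_bouquet ar \<Phi>"
    and "bv \<Psi> \<inter> (bv \<Phi> \<union> fv \<Phi>) = {}" "bv \<Phi> \<inter> fv \<Psi> = {}"
    and "binders \<Theta> = binders \<Psi> + binders \<Phi>" "fv \<Theta> = fv \<Psi> \<union> fv \<Phi>"
    and "respects_arity ar \<Theta> \<longleftrightarrow> respects_arity ar \<Psi> \<and> respects_arity ar \<Phi>"
  shows "is_bouquet ar \<Theta>"
proof -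
  have "count (binders \<Theta>) v \<le> 1" for v
  proof (cases "v \<in># binders \<Psi>")
    case True
    then have "v \<notin># binders \<Phi>" using assms(3) by (auto simp: set_mset_binders)
    then show ?thesis
      using assms(1,5) by (simp add: is_bouquet_def var_convention_def not_in_iff)
  next
    case False
    then show ?thesis
      using assms(2,5) by (simp add: is_bouquet_def var_convention_def not_in_iff)
  qed
  moreover have "bv \<Theta> = bv \<Psi> \<union> bv \<Phi>"
    using assms(5) by (simp flip: set_mset_binders)
  ultimately show ?thesis
    using assms by (auto simp: is_bouquet_def var_convention_def)
qed

section \<open>Derivability and its closure under positive contexts\<close>

lemma derives_refl_alpha: "\<Phi> \<approx> \<Psi> \<Longrightarrow> derives ar R \<Phi> \<Psi>"
  unfolding derives_def by blast

lemma derives_trans [trans]: "derives ar R \<Phi> \<Psi> \<Longrightarrow> derives ar R \<Psi> \<Theta> \<Longrightarrow> derives ar R \<Phi> \<Theta>"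
  unfolding derives_def by (rule rtranclp_trans)

text \<open>The case of \<open>step\<close> in which both renamings of binders are trivial; explicit
  renamings are instead supplied by \<open>derives_refl_alpha\<close>.\<close>

lemma derives_rule:
  assumes "R \<Phi> \<Psi>" "is_bouquet ar \<Phi>" "respects_arity ar \<Psi>" "bv \<Phi> \<inter> fv \<Psi> = {}"
  shows "derives ar R \<Phi> \<Psi>"
  using assms unfolding derives_def step_def by (blast intro: alpha_eq_refl)

text \<open>The hypotheses on \<^term>\<open>C\<close> say that \<^term>\<open>C \<Theta>\<close> is a positive context made of the
  bouquet \<^term>\<open>\<Theta>\<close> in which no sprinkler binds in the hole.\<close>

lemma derives_fill:
  fixes C :: "('p, 'v) bouquet \<Rightarrow> ('p, 'v) bctx"
  assumes inf: "infinite (UNIV :: 'v set)"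
    and pos: "\<And>\<Theta>. positive (C \<Theta>)"
    and binders: "\<And>\<Theta> \<Phi>. binders (fill (C \<Theta>) \<Phi>) = binders \<Theta> + binders \<Phi>"
    and fv: "\<And>\<Theta> \<Phi>. fv (fill (C \<Theta>) \<Phi>) = fv \<Theta> \<union> fv \<Phi>"
    and arity: "\<And>\<Theta> \<Phi>.
      respects_arity ar (fill (C \<Theta>) \<Phi>) \<longleftrightarrow> respects_arity ar \<Theta> \<and> respects_arity ar \<Phi>"
    and alpha: "\<And>\<Theta> \<Theta>' \<Phi>. \<Theta> \<approx> \<Theta>' \<Longrightarrow> fill (C \<Theta>) \<Phi> \<approx> fill (C \<Theta>') \<Phi>"
    and \<Theta>: "is_bouquet ar \<Theta>"
    and "derives ar full_step \<Phi> \<Psi>"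
  shows "derives ar full_step (fill (C \<Theta>) \<Phi>) (fill (C \<Theta>) \<Psi>)"
  using assms(8)[unfolded derives_def]
proof (induction rule: rtranclp_induct)
  case base
  show ?case by (simp add: derives_refl_alpha)
next
  case (step A B)
  have "derives ar full_step (fill (C \<Theta>) A) (fill (C \<Theta>) B)"
  proof (cases "A \<approx> B")
    case True
    then show ?thesis by (simp add: derives_refl_alpha alpha_eq_fill)
  next
    case False
    with step.hyps(2) obtain A' B' where AB: "A \<approx> A'" "B' \<approx> B" "full_step A' B'"
      "is_bouquet ar A'" "respects_arity ar B'" "bv A' \<inter> fv B' = {}"
      unfolding step_def by blast
    have A': "respects_arity ar A'" "\<forall>v. count (binders A') v \<le> 1" "bv A' \<inter> fv A' = {}"
      using AB(4) by (auto simp: is_bouquet_def var_convention_def)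
    \<comment> \<open>The side condition of \<open>step\<close> keeps the binders of
      \<open>A'\<close> apart from \<open>fv B'\<close>. Hence one bijection can move these binders
      away from \<open>fv \<Theta>\<close> and still fix the free variables of both sides, so that
      each side is equivalent to its image.\<close>
    have "finite (fv A' \<union> fv B')" "finite (fv \<Theta> \<union> fv A' \<union> fv B')"
      "bv A' \<inter> (fv A' \<union> fv B') = {}"
      using finite_fv AB(6) A'(3) by auto
    then obtain \<pi> where \<pi>: "bij \<pi>" "\<forall>v \<in> fv A' \<union> fv B'. \<pi> v = v"
        "\<pi> ` bv A' \<inter> (fv \<Theta> \<union> fv A' \<union> fv B') = {}"
      using fresh_bij[OF inf finite_bv] by metis
    have inj: "inj \<pi>" by (rule bij_is_inj[OF \<pi>(1)])
    have A\<pi>: "A' \<approx> rename \<pi> A'" and B\<pi>: "B' \<approx> rename \<pi> B'"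
      using \<pi>(2) by (auto intro: rename_alpha_eq[OF \<pi>(1)])
    have fv\<pi>: "fv (rename \<pi> A') = fv A'" "fv (rename \<pi> B') = fv B'"
      using \<pi>(2) by (simp_all add: fv_rename[OF inj])
    have bv\<pi>: "bv (rename \<pi> A') \<inter> (fv \<Theta> \<union> fv A' \<union> fv B') = {}"
      using \<pi>(3) by (simp add: bv_rename[OF inj])
    have A'': "is_bouquet ar (rename \<pi> A')"
      using A'(1) distinct_binders_rename[OF \<pi>(1) A'(2)] fv\<pi> bv\<pi>
      by (auto simp: is_bouquet_def var_convention_def respects_arity_rename)
    \<comment> \<open>The binders of the context bouquet are refreshed after those of the step, so
      that they avoid the new binders and the free variables of both sides.\<close>
    obtain \<Theta>' where \<Theta>': "\<Theta> \<approx> \<Theta>'" "is_bouquet ar \<Theta>'" "fv \<Theta>' = fv \<Theta>"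
        "bv \<Theta>' \<inter> (bv (rename \<pi> A') \<union> fv A' \<union> fv B') = {}"
      using fresh_copy[OF inf \<Theta>, of "bv (rename \<pi> A') \<union> fv A' \<union> fv B'"] finite_bv finite_fv
      by (metis finite_UnI)
    have bv: "bv (fill (C \<Theta>') (rename \<pi> A')) = bv \<Theta>' \<union> bv (rename \<pi> A')"
      by (simp add: binders flip: set_mset_binders)
    have \<Theta>'_conv: "bv \<Theta>' \<inter> fv \<Theta>' = {}" "respects_arity ar \<Theta>'"
      using \<Theta>'(2) by (auto simp: is_bouquet_def var_convention_def)
    have "fill (C \<Theta>) A \<approx> fill (C \<Theta>') (rename \<pi> A')"
      by (rule alpha_eq_trans[OF alpha_eq_fill[OF alpha_eq_trans[OF AB(1) A\<pi>]] alpha[OF \<Theta>'(1)]])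
    moreover have "derives ar full_step (fill (C \<Theta>') (rename \<pi> A')) (fill (C \<Theta>') (rename \<pi> B'))"
    proof (rule derives_rule)
      show "full_step (fill (C \<Theta>') (rename \<pi> A')) (fill (C \<Theta>') (rename \<pi> B'))"
        by (intro full_step_fill full_step_rename \<pi>(1) AB(3) pos)
      show "is_bouquet ar (fill (C \<Theta>') (rename \<pi> A'))"
        using \<Theta>'(3,4) fv\<pi> bv\<pi>
        by (intro is_bouquet_apart[OF \<Theta>'(2) A'' _ _ binders fv arity]) blast+
      show "respects_arity ar (fill (C \<Theta>') (rename \<pi> B'))"
        using \<Theta>'_conv AB(5) by (simp add: arity respects_arity_rename)
      show "bv (fill (C \<Theta>') (rename \<pi> A')) \<inter> fv (fill (C \<Theta>') (rename \<pi> B')) = {}"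
        unfolding bv fv fv\<pi> \<Theta>'(3) using \<Theta>'_conv(1) \<Theta>'(3,4) bv\<pi> by blast
    qed
    moreover have "fill (C \<Theta>') (rename \<pi> B') \<approx> fill (C \<Theta>) B"
      by (rule alpha_eq_trans[OF alpha_eq_fill[OF alpha_eq_trans[OF alpha_eq_sym[OF B\<pi>] AB(2)]]
            alpha[OF alpha_eq_sym[OF \<Theta>'(1)]]])
    ultimately show ?thesis
      by (meson derives_refl_alpha derives_trans)
  qed
  with step.IH show ?case by (rule derives_trans)
qed

lemma derives_union_left:
  fixes \<Phi> \<Psi> \<Theta> :: "('p, 'v) bouquet"
  assumes "infinite (UNIV :: 'v set)" "is_bouquet ar \<Theta>" "derives ar full_step \<Phi> \<Psi>"
  shows "derives ar full_step (\<Theta> + \<Phi>) (\<Theta> + \<Psi>)"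
  using derives_fill[of "\<lambda>\<Theta>. Beside \<Theta> Hole", OF assms(1) _ _ _ _ _ assms(2,3)]
  by (simp add: alpha_eq_union)

text \<open>A petal adds no inversion, and its empty sprinkler binds nothing in the hole.\<close>

lemma derives_petal:
  fixes \<Phi> \<Psi> \<Theta> :: "('p, 'v) bouquet"
  assumes "infinite (UNIV :: 'v set)" "is_bouquet ar \<Theta>" "derives ar full_step \<Phi> \<Psi>"
  shows "derives ar full_step {# bouquet_flower \<Theta> \<Phi> #} {# bouquet_flower \<Theta> \<Psi> #}"
  using derives_fill[of "\<lambda>\<Theta>. Beside {#} (In_Petal ({||} \<cdot> \<Theta>) {||} (Beside {#} Hole) {#})",
      OF assms(1) _ _ _ _ _ assms(2,3)]
  by (simp add: alpha_eq_bouquet_flower)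

section \<open>Erasing and creating the flower of the theorem\<close>

lemma natural_rule_full_step: "natural_rule \<Phi> \<Psi> \<Longrightarrow> full_step \<Phi> \<Psi>"
  using natural_step.intros[of \<Phi> \<Psi> "Beside {#} Hole"] by simp

text \<open>With the same bouquet in pistil and petal, binders would occur twice. The petal is
  therefore replaced by a fresh copy, which the pistil pollinates away; \<open>epet\<close> then
  removes the flower with its empty petal.\<close>

lemma derives_bouquet_flower_self:
  fixes \<Psi> :: "('p, 'v) bouquet"
  assumes inf: "infinite (UNIV :: 'v set)" and \<Psi>: "is_bouquet ar \<Psi>"
  shows "derives ar full_step {# bouquet_flower \<Psi> \<Psi> #} {#}"
proof -
  obtain \<Psi>' where \<Psi>': "\<Psi> \<approx> \<Psi>'" "is_bouquet ar \<Psi>'" "fv \<Psi>' = fv \<Psi>" "bv \<Psi>' \<inter> (bv \<Psi> \<union> fv \<Psi>) = {}"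
    and copy: "\<And>\<psi>'. \<psi>' \<in># \<Psi>' \<Longrightarrow> \<exists>\<psi> \<in># \<Psi>. {# \<psi> #} \<approx> {# \<psi>' #}"
    using fresh_copy[OF inf \<Psi>, of "bv \<Psi> \<union> fv \<Psi>"] finite_bv finite_fv by (metis finite_UnI)
  have conv: "bv \<Psi> \<inter> fv \<Psi> = {}" "respects_arity ar \<Psi>"
    using \<Psi> by (auto simp: is_bouquet_def var_convention_def)
  have "derives ar full_step {# bouquet_flower \<Psi> \<Psi> #} {# bouquet_flower \<Psi> \<Psi>' #}"
    by (intro derives_refl_alpha alpha_eq_bouquet_flower \<Psi>'(1) alpha_eq_refl)
  also have "derives ar full_step {# bouquet_flower \<Psi> \<Psi>' #} {# bouquet_flower \<Psi> {#} #}"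
  proof (rule derives_rule)
    let ?\<Xi> = "Beside {#} (In_Petal ({||} \<cdot> \<Psi>) {||} (Beside {#} Hole) {#})"
    \<comment> \<open>This exhibits the second form of pollination, from pistil to petal, with a
      trivial outer context.\<close>
    have "?\<Xi> = ctx_comp (Beside {#} Hole) ?\<Xi>"
      by simp
    then have "pollinated \<Psi>' ?\<Xi>"
      unfolding pollinated_def pollinated_flower_def using copy by blast
    then show "full_step {# bouquet_flower \<Psi> \<Psi>' #} {# bouquet_flower \<Psi> {#} #}"
      using natural_rule_full_step[OF poll_down, of \<Psi>' ?\<Xi>] by simp
    show "is_bouquet ar {# bouquet_flower \<Psi> \<Psi>' #}"
      using conv \<Psi>'(3,4) by (intro is_bouquet_apart[OF \<Psi> \<Psi>'(2)]) auto
  qed (use conv \<Psi>'(4) in auto)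
  also have "derives ar full_step {# bouquet_flower \<Psi> {#} #} {#}"
  proof (rule derives_rule)
    show "full_step {# bouquet_flower \<Psi> {#} #} {#}"
      by (intro natural_rule_full_step epet)
    show "is_bouquet ar {# bouquet_flower \<Psi> {#} #}"
      using \<Psi> by (simp add: is_bouquet_def var_convention_def)
  qed auto
  finally show ?thesis .
qed

text \<open>\<open>epis\<close> wraps \<open>\<Phi>\<close> in a flower with empty pistil,
  \<open>grow\<close> adds \<open>\<Psi>\<close> beside it at the top level, which is positive, and
  \<open>poll_up\<close> copies \<open>\<Psi>\<close> into the pistil. All three steps act on fresh
  copies.\<close>

lemma derives_detach:
  fixes \<Phi> \<Psi> :: "('p, 'v) bouquet"
  assumes inf: "infinite (UNIV :: 'v set)" and \<Phi>: "is_bouquet ar \<Phi>" and \<Psi>: "is_bouquet ar \<Psi>"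
  shows "derives ar full_step \<Phi> (\<Psi> + {# bouquet_flower \<Psi> \<Phi> #})"
proof -
  \<comment> \<open>The step \<open>grow\<close> introduces the free variables of
    \<open>\<Psi>\<close> in its premiss, so they must not be bound in
    \<open>\<Phi>'\<close>.\<close>
  obtain \<Phi>' where \<Phi>': "\<Phi> \<approx> \<Phi>'" "is_bouquet ar \<Phi>'" "fv \<Phi>' = fv \<Phi>" "bv \<Phi>' \<inter> fv \<Psi> = {}"
    using fresh_copy[OF inf \<Phi> finite_fv] by metis
  obtain \<Psi>' where \<Psi>': "\<Psi> \<approx> \<Psi>'" "is_bouquet ar \<Psi>'" "fv \<Psi>' = fv \<Psi>"
      "bv \<Psi>' \<inter> (bv \<Phi>' \<union> fv \<Phi>') = {}"
    using fresh_copy[OF inf \<Psi>, of "bv \<Phi>' \<union> fv \<Phi>'"] finite_bv finite_fv by (metis finite_UnI)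
  have \<Phi>'_conv: "bv \<Phi>' \<inter> fv \<Phi>' = {}" "respects_arity ar \<Phi>'"
    using \<Phi>'(2) by (auto simp: is_bouquet_def var_convention_def)
  have \<Psi>'_conv: "bv \<Psi>' \<inter> fv \<Psi>' = {}" "respects_arity ar \<Psi>'"
    using \<Psi>'(2) by (auto simp: is_bouquet_def var_convention_def)
  let ?\<phi> = "bouquet_flower {#} \<Phi>'"
  have "derives ar full_step \<Phi> \<Phi>'"
    by (rule derives_refl_alpha[OF \<Phi>'(1)])
  also have "derives ar full_step \<Phi>' {# ?\<phi> #}"
    using \<Phi>'_conv by (intro derives_rule natural_rule_full_step epis \<Phi>'(2)) auto
  also have "derives ar full_step {# ?\<phi> #} (\<Psi>' + {# ?\<phi> #})"
  proof (rule derives_rule)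
    show "full_step {# ?\<phi> #} (\<Psi>' + {# ?\<phi> #})"
      using cultural_step.grow[of "Beside {# ?\<phi> #} Hole" \<Psi>'] by simp
    show "is_bouquet ar {# ?\<phi> #}"
      using \<Phi>'(2) by (simp add: is_bouquet_def var_convention_def)
  qed (use \<Phi>'_conv \<Phi>'(4) \<Psi>'(3) \<Psi>'_conv in \<open>auto simp del: union_mset_add_mset_right\<close>)
  also have "derives ar full_step (\<Psi>' + {# ?\<phi> #}) (\<Psi>' + {# bouquet_flower \<Psi>' \<Phi>' #})"
  proof (rule derives_rule)
    let ?\<xi> = "In_Pistil {||} (Beside {#} Hole) {# {||} \<cdot> \<Phi>' #}"
    \<comment> \<open>This is the first form of pollination: \<open>\<Psi>'\<close> stands beside
      the flower whose pistil contains the hole.\<close>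
    have "Beside \<Psi>' ?\<xi> = ctx_comp (Beside {#} Hole) (beside \<Psi>' (Beside {#} ?\<xi>))"
      by simp
    then have "pollinated \<Psi>' (Beside \<Psi>' ?\<xi>)"
      unfolding pollinated_def pollinated_flower_def using alpha_eq_refl by blast
    then show "full_step (\<Psi>' + {# ?\<phi> #}) (\<Psi>' + {# bouquet_flower \<Psi>' \<Phi>' #})"
      using natural_rule_full_step[OF poll_up, of \<Psi>' "Beside \<Psi>' ?\<xi>"] by simp
    show "is_bouquet ar (\<Psi>' + {# ?\<phi> #})"
      using \<Phi>'(4) \<Psi>'(3,4)
      by (intro is_bouquet_apart[OF \<Psi>'(2) \<Phi>'(2)]) (auto simp del: union_mset_add_mset_right)
  qed (use \<Phi>'_conv \<Phi>'(4) \<Psi>'(3,4) \<Psi>'_conv in \<open>auto simp del: union_mset_add_mset_right\<close>)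
  also have "derives ar full_step (\<Psi>' + {# bouquet_flower \<Psi>' \<Phi>' #}) (\<Psi> + {# bouquet_flower \<Psi> \<Phi> #})"
    by (intro derives_refl_alpha alpha_eq_union alpha_eq_bouquet_flower alpha_eq_sym[OF \<Psi>'(1)]
        alpha_eq_sym[OF \<Phi>'(1)])
  finally show ?thesis .
qed

theorem mainTheorem1:
  fixes ar :: "'p::countable \<Rightarrow> nat"
    and \<Phi> \<Psi> :: "('p, 'v::countable) bouquet"
  assumes "infinite (UNIV :: 'v set)"
    and "is_bouquet ar \<Phi>" and "is_bouquet ar \<Psi>"
  shows "derives ar full_step \<Phi> \<Psi> \<longleftrightarrow> derives ar full_step {# bouquet_flower \<Psi> \<Phi> #} {#}"
proof
  assume "derives ar full_step \<Phi> \<Psi>"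
  from derives_petal[OF assms(1,3) this] derives_bouquet_flower_self[OF assms(1,3)]
  show "derives ar full_step {# bouquet_flower \<Psi> \<Phi> #} {#}"
    by (rule derives_trans)
next
  assume "derives ar full_step {# bouquet_flower \<Psi> \<Phi> #} {#}"
  \<comment> \<open>Erasing the flower beside \<open>\<Psi>\<close> leaves
    \<open>\<Psi> + {#}\<close>, which is \<open>\<Psi>\<close>.\<close>
  from derives_detach[OF assms] derives_union_left[OF assms(1,3) this]
  show "derives ar full_step \<Phi> \<Psi>"
    using derives_trans by fastforce
qed

end
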